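(* Let $\Gamma$ be a finitely generated non-amenable group and let $\Sigma \subset \Gamma$ be a finite symmetric generating set. For every integer $k \geq 1$ there exists a (non-empty) symmetric set $S_k \subset \Sigma^k$ such that $$\rho(S_k) \leq 4k \cdot \ln(|\Sigma|) \cdot \rho(\Sigma)^k.$$ Moreover, for every $\varepsilon > 0$ there exists a finite symmetric generating set $S \subset \Gamma$ such that $\rho(S) < \varepsilon$.
   Context: Groups are discrete. A subset $S \subset \Gamma$ is symmetric if $g \in S$ implies $g^{-1} \in S$. For $\Sigma \subset \Gamma$ and $k \geq 1$, $\Sigma^k$ denotes the set of all products of $k$ factors from $\Sigma$. Let $\lambda \colon \Gamma \to \mathcal{U}(\ell^2\Gamma)$, $\lambda(g)\delta_h = \delta_{gh}$, be the left-regular representation, extended linearly to the group ring $\mathbb{C}[\Gamma] \to B(\ell^2\Gamma)$; for $a \in \mathbb{C}[\Gamma]$, $\|a\|$ denotes the operator norm of $\lambda(a)$. For a non-empty finite symmetric subset $S \subset \Gamma$, the Markov operator is $m(S) := \frac{1}{|S|}\sum_{s \in S} s \in \mathbb{C}[\Gamma]$, and the spectral radius is $\rho(S) := \|m(S)\|$. $\ln$ is the natural logarithm. *)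

theory Defs
  imports
    "HOL-Algebra.Generated_Groups"
    "HOL-Analysis.Infinite_Sum"
    "HOL-Library.Poly_Mapping"
begin

definition symmetric_subset :: "('a, 'b) monoid_scheme \<Rightarrow> 'a set \<Rightarrow> bool" where
  "symmetric_subset G S \<longleftrightarrow> S \<subseteq> carrier G \<and> (\<forall>g\<in>S. inv\<^bsub>G\<^esub> g \<in> S)"

definition generating_set :: "('a, 'b) monoid_scheme \<Rightarrow> 'a set \<Rightarrow> bool" where
  "generating_set G S \<longleftrightarrow> S \<subseteq> carrier G \<and> generate G S = carrier G"

definition finitely_generated :: "('a, 'b) monoid_scheme \<Rightarrow> bool" where
  "finitely_generated G \<longleftrightarrow> (\<exists>S. finite S \<and> generating_set G S)"

definition set_pow :: "('a, 'b) monoid_scheme \<Rightarrow> 'a set \<Rightarrow> nat \<Rightarrow> 'a set" where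
  "set_pow G S k = {foldr (\<otimes>\<^bsub>G\<^esub>) xs \<one>\<^bsub>G\<^esub> | xs. length xs = k \<and> set xs \<subseteq> S}"

(* Amenability of a discrete group in von Neumann's sense: there is a finitely additive
   probability measure, defined on all subsets, that is invariant under left translation. *)
definition amenable :: "('a, 'b) monoid_scheme \<Rightarrow> bool" where
  "amenable G \<longleftrightarrow>
     (\<exists>\<mu> :: 'a set \<Rightarrow> real.
        (\<forall>A. A \<subseteq> carrier G \<longrightarrow> 0 \<le> \<mu> A) \<and>
        \<mu> (carrier G) = 1 \<and>
        (\<forall>A B. A \<subseteq> carrier G \<longrightarrow> B \<subseteq> carrier G \<longrightarrow> A \<inter> B = {} \<longrightarrow> \<mu> (A \<union> B) = \<mu> A + \<mu> B) \<and>
        (\<forall>g\<in>carrier G. \<forall>A. A \<subseteq> carrier G \<longrightarrow> \<mu> (g <#\<^bsub>G\<^esub> A) = \<mu> A))"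

(* The Hilbert space of square-summable functions on X. Its elements are represented by
   functions on the whole type that vanish outside X. *)
definition ell2 :: "'a set \<Rightarrow> ('a \<Rightarrow> complex) set" where
  "ell2 X = {f. (\<forall>x. x \<notin> X \<longrightarrow> f x = 0) \<and> (\<lambda>x. (cmod (f x))\<^sup>2) summable_on X}"

definition ell2_norm :: "'a set \<Rightarrow> ('a \<Rightarrow> complex) \<Rightarrow> real" where
  "ell2_norm X f = sqrt (\<Sum>\<^sub>\<infinity>x\<in>X. (cmod (f x))\<^sup>2)"

definition ell2_opnorm :: "'a set \<Rightarrow> (('a \<Rightarrow> complex) \<Rightarrow> ('a \<Rightarrow> complex)) \<Rightarrow> real" where
  "ell2_opnorm X T = (SUP f\<in>{f \<in> ell2 X. ell2_norm X f \<le> 1}. ell2_norm X (T f))"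

(* The formula (g f)(x) = f (g^-1 x) is the linear extension of delta_h |-> delta_(g h);
   see left_regular_delta. *)
definition left_regular :: "('a, 'b) monoid_scheme \<Rightarrow> 'a \<Rightarrow> ('a \<Rightarrow> complex) \<Rightarrow> ('a \<Rightarrow> complex)" where
  "left_regular G g f = (\<lambda>x. if x \<in> carrier G then f (inv\<^bsub>G\<^esub> g \<otimes>\<^bsub>G\<^esub> x) else 0)"

lemma (in group) left_regular_delta:
  assumes "g \<in> carrier G" "h \<in> carrier G"
  shows "left_regular G g (indicator {h}) = indicator {g \<otimes> h}"
proof
  fix x
  have "inv g \<otimes> x = h \<longleftrightarrow> x = g \<otimes> h" if "x \<in> carrier G"
    using assms that by (metis inv_solve_left)
  then show "left_regular G g (indicator {h}) x = (indicator {g \<otimes> h} x :: complex)"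
    using assms by (auto simp: left_regular_def indicator_def)
qed

(* Elements of the complex group ring are finitely supported functions whose support
   (keys) lies in the carrier of G. *)
definition group_ring_op ::
    "('a, 'b) monoid_scheme \<Rightarrow> ('a \<Rightarrow>\<^sub>0 complex) \<Rightarrow> ('a \<Rightarrow> complex) \<Rightarrow> ('a \<Rightarrow> complex)" where
  "group_ring_op G a f =
     (\<lambda>x. \<Sum>g\<in>Poly_Mapping.keys a. Poly_Mapping.lookup a g * left_regular G g f x)"

definition group_ring_norm :: "('a, 'b) monoid_scheme \<Rightarrow> ('a \<Rightarrow>\<^sub>0 complex) \<Rightarrow> real" where
  "group_ring_norm G a = ell2_opnorm (carrier G) (group_ring_op G a)"

definition markov :: "'a set \<Rightarrow> ('a \<Rightarrow>\<^sub>0 complex)" where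
  "markov S = (\<Sum>s\<in>S. Poly_Mapping.single s (1 / of_nat (card S)))"

definition spectral_radius :: "('a, 'b) monoid_scheme \<Rightarrow> 'a set \<Rightarrow> real" where
  "spectral_radius G S = group_ring_norm G (markov S)"

end

theory Submission
  imports Defs "HOL-Analysis.Harmonic_Numbers" "HOL-Analysis.Function_Topology"
begin

text \<open>
  The \<open>k\<close>-th power of the Markov operator of \<open>\<Sigma>\<close> is convolution with the probability measure \<open>p\<close> that
  describes the product of \<open>k\<close> independent uniform letters, and its norm is at most the \<open>k\<close>-th power of
  the spectral radius of \<open>\<Sigma>\<close>. It remains to replace \<open>p\<close> by a uniform measure on a set. The
  indicator function of a superlevel set \<open>{p \<ge> t}\<close> is at most \<open>p / t\<close>, and convolution norms are
  monotone in nonnegative coefficients, so the spectral radius of the superlevel set exceeds the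
  norm for \<open>p\<close> at most by the factor \<open>1 / (t * card {p \<ge> t})\<close>
  (\<open>spectral_radius_level_set_le\<close>). If this factor were larger than \<open>C\<close> for all levels, the \<open>i\<close>-th
  largest value of \<open>p\<close> would be less than \<open>1 / (C * i)\<close>. Summing over the support of \<open>p\<close>, which has
  at most \<open>card \<Sigma> ^ k\<close> elements, shows that \<open>C\<close> is less than a harmonic number, so some level achieves
  \<open>1 + k * ln (card \<Sigma>)\<close> (\<open>sum_le_harm\<close>, \<open>exists_level_set\<close>). This is at most
  \<open>4 * k * ln (card \<Sigma>)\<close> when \<open>card \<Sigma> \<ge> 2\<close>, and a group with fewer symmetric generators is finite and
  hence amenable. Superlevel sets are symmetric because \<open>p\<close> is.

  For the second claim, adjoin the identity to \<open>\<Sigma>\<close>. By Kesten's criterion the spectral radius is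
  then less than \<open>1\<close> (\<open>spectral_radius_less_one\<close>): if it were \<open>1\<close>, there would be vectors of norm
  nearly \<open>1\<close> that are almost invariant under the generators, and a limit of the measures with the squares
  of their absolute values as densities would be an invariant mean. Hence the bound of the first claim tends to \<open>0\<close> as
  \<open>k\<close> grows. The resulting sets are large, since a set of cardinality \<open>n\<close> has spectral radius at least
  \<open>1 / sqrt n\<close>, so adding the generators to them changes the spectral radius only a little
  (\<open>spectral_radius_Un_le\<close>).
\<close>

section \<open>Square-summable functions\<close>

abbreviation square_summable :: "'a set \<Rightarrow> ('a \<Rightarrow> complex) \<Rightarrow> bool" where
  "square_summable A f \<equiv> (\<lambda>x. (cmod (f x))\<^sup>2) summable_on A"

lemma ell2_norm_nonneg: "0 \<le> ell2_norm A f"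
  by (simp add: ell2_norm_def infsum_nonneg)

lemma ell2_norm_power2: "(ell2_norm A f)\<^sup>2 = (\<Sum>\<^sub>\<infinity>x\<in>A. (cmod (f x))\<^sup>2)"
  by (simp add: ell2_norm_def infsum_nonneg)

lemma L2_set_le_ell2_norm:
  assumes "square_summable A f" "finite F" "F \<subseteq> A"
  shows "L2_set (\<lambda>x. cmod (f x)) F \<le> ell2_norm A f"
  unfolding L2_set_def ell2_norm_def
  using assms by (intro real_sqrt_le_mono finite_sum_le_infsum) auto

text \<open>Bounds on finite partial norms transfer to the infinite sum. Monotonicity and the triangle
inequality thus reduce to their counterparts for \<^const>\<open>L2_set\<close>.\<close>

lemma square_summable_if_L2_set_le:
  assumes "\<And>F. finite F \<Longrightarrow> F \<subseteq> A \<Longrightarrow> L2_set (\<lambda>x. cmod (f x)) F \<le> c"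
  shows "square_summable A f" and "ell2_norm A f \<le> c"
proof -
  have c: "0 \<le> c" using assms[of "{}"] by simp
  have sum_le: "(\<Sum>x\<in>F. (cmod (f x))\<^sup>2) \<le> c\<^sup>2" if "finite F" "F \<subseteq> A" for F
    using assms[OF that] unfolding L2_set_def by (metis sqrt_le_D)
  show "square_summable A f"
    by (rule nonneg_bdd_above_summable_on) (auto intro!: bdd_aboveI2 sum_le)
  then have "(ell2_norm A f)\<^sup>2 \<le> c\<^sup>2"
    unfolding ell2_norm_power2 by (rule infsum_le_finite_sums) (rule sum_le)
  then show "ell2_norm A f \<le> c"
    using c by (rule power2_le_imp_le)
qed

lemma ell2_norm_mono:
  assumes "square_summable A g" "0 \<le> c" "\<And>x. x \<in> A \<Longrightarrow> cmod (f x) \<le> c * cmod (g x)"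
  shows "square_summable A f" and "ell2_norm A f \<le> c * ell2_norm A g"
proof -
  have "L2_set (\<lambda>x. cmod (f x)) F \<le> c * ell2_norm A g" if F: "finite F" "F \<subseteq> A" for F
  proof -
    have "L2_set (\<lambda>x. cmod (f x)) F \<le> L2_set (\<lambda>x. c * cmod (g x)) F"
      using assms(3) F by (intro L2_set_mono) auto
    also have "\<dots> = c * L2_set (\<lambda>x. cmod (g x)) F"
      using assms(2) by (simp add: L2_set_right_distrib)
    also have "\<dots> \<le> c * ell2_norm A g"
      using assms F by (intro mult_left_mono L2_set_le_ell2_norm)
    finally show ?thesis .
  qed
  then show "square_summable A f" and "ell2_norm A f \<le> c * ell2_norm A g"
    by (rule square_summable_if_L2_set_le; blast)+
qed

lemma ell2_norm_triangle:
  assumes "square_summable A f" "square_summable A g"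
  shows "square_summable A (\<lambda>x. f x + g x)"
    and "ell2_norm A (\<lambda>x. f x + g x) \<le> ell2_norm A f + ell2_norm A g"
proof -
  have "L2_set (\<lambda>x. cmod (f x + g x)) F \<le> ell2_norm A f + ell2_norm A g"
    if F: "finite F" "F \<subseteq> A" for F
  proof -
    have "L2_set (\<lambda>x. cmod (f x + g x)) F \<le> L2_set (\<lambda>x. cmod (f x) + cmod (g x)) F"
      by (intro L2_set_mono) (auto intro: norm_triangle_ineq)
    also have "\<dots> \<le> L2_set (\<lambda>x. cmod (f x)) F + L2_set (\<lambda>x. cmod (g x)) F"
      by (rule L2_set_triangle_ineq)
    also have "\<dots> \<le> ell2_norm A f + ell2_norm A g"
      using assms F by (intro add_mono L2_set_le_ell2_norm)
    finally show ?thesis .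
  qed
  then show "square_summable A (\<lambda>x. f x + g x)"
    and "ell2_norm A (\<lambda>x. f x + g x) \<le> ell2_norm A f + ell2_norm A g"
    by (rule square_summable_if_L2_set_le; blast)+
qed

lemma ell2_norm_scale:
  assumes "square_summable A f"
  shows "square_summable A (\<lambda>x. c * f x)" and "ell2_norm A (\<lambda>x. c * f x) = cmod c * ell2_norm A f"
proof -
  show "square_summable A (\<lambda>x. c * f x)"
    using assms by (simp add: norm_mult power_mult_distrib summable_on_cmult_right)
  show "ell2_norm A (\<lambda>x. c * f x) = cmod c * ell2_norm A f"
    using assms by (simp add: ell2_norm_def norm_mult power_mult_distrib infsum_cmult_right real_sqrt_mult)
qed

lemma ell2_norm_diff:
  assumes "square_summable A f" "square_summable A g"
  shows "square_summable A (\<lambda>x. f x - g x)"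
    and "\<bar>ell2_norm A f - ell2_norm A g\<bar> \<le> ell2_norm A (\<lambda>x. f x - g x)"
proof -
  note neg = ell2_norm_scale[OF assms(2), of "-1"]
  show diff: "square_summable A (\<lambda>x. f x - g x)"
    using ell2_norm_triangle(1)[OF assms(1) neg(1)] by simp
  note neg_diff = ell2_norm_scale[OF diff, of "-1"]
  show "\<bar>ell2_norm A f - ell2_norm A g\<bar> \<le> ell2_norm A (\<lambda>x. f x - g x)"
    using ell2_norm_triangle(2)[OF assms(2) diff] ell2_norm_triangle(2)[OF assms(1) neg_diff(1)]
      neg_diff(2) by simp
qed

lemma ell2_norm_sum:
  assumes "finite I" "\<And>i. i \<in> I \<Longrightarrow> square_summable A (f i)"
  shows "square_summable A (\<lambda>x. \<Sum>i\<in>I. f i x)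
    \<and> ell2_norm A (\<lambda>x. \<Sum>i\<in>I. f i x) \<le> (\<Sum>i\<in>I. ell2_norm A (f i))"
  using assms
proof (induction I)
  case empty
  then show ?case by (simp add: ell2_norm_def)
next
  case (insert i I)
  then have IH: "square_summable A (\<lambda>x. \<Sum>i\<in>I. f i x)"
      "ell2_norm A (\<lambda>x. \<Sum>i\<in>I. f i x) \<le> (\<Sum>i\<in>I. ell2_norm A (f i))"
    and i: "square_summable A (f i)" by auto
  show ?case
    using ell2_norm_triangle[OF i IH(1)] IH(2) insert.hyps by simp
qed

lemma ell2_norm_parallelogram:
  assumes "square_summable A f" "square_summable A g"
  shows "(ell2_norm A (\<lambda>x. f x + g x))\<^sup>2 + (ell2_norm A (\<lambda>x. f x - g x))\<^sup>2
    = 2 * (ell2_norm A f)\<^sup>2 + 2 * (ell2_norm A g)\<^sup>2"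
proof -
  have pointwise: "(cmod (a + b))\<^sup>2 + (cmod (a - b))\<^sup>2 = 2 * (cmod a)\<^sup>2 + 2 * (cmod b)\<^sup>2" for a b
    unfolding cmod_power2 by (simp add: power2_eq_square algebra_simps)
  have "(\<Sum>\<^sub>\<infinity>x\<in>A. (cmod (f x + g x))\<^sup>2) + (\<Sum>\<^sub>\<infinity>x\<in>A. (cmod (f x - g x))\<^sup>2)
    = (\<Sum>\<^sub>\<infinity>x\<in>A. (cmod (f x + g x))\<^sup>2 + (cmod (f x - g x))\<^sup>2)"
    using assms by (intro infsum_add[symmetric] ell2_norm_triangle ell2_norm_diff)
  also have "\<dots> = (\<Sum>\<^sub>\<infinity>x\<in>A. 2 * (cmod (f x))\<^sup>2 + 2 * (cmod (g x))\<^sup>2)"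
    by (simp add: pointwise)
  also have "\<dots> = 2 * (\<Sum>\<^sub>\<infinity>x\<in>A. (cmod (f x))\<^sup>2) + 2 * (\<Sum>\<^sub>\<infinity>x\<in>A. (cmod (g x))\<^sup>2)"
    using assms by (simp add: infsum_add infsum_cmult_right summable_on_cmult_right)
  finally show ?thesis by (simp only: ell2_norm_power2)
qed

lemma ell2_norm_subset:
  assumes "square_summable B f" "A \<subseteq> B"
  shows "square_summable A f" and "ell2_norm A f \<le> ell2_norm B f"
proof -
  have "L2_set (\<lambda>x. cmod (f x)) F \<le> ell2_norm B f" if "finite F" "F \<subseteq> A" for F
    using assms that by (intro L2_set_le_ell2_norm) auto
  then show "square_summable A f" and "ell2_norm A f \<le> ell2_norm B f"
    by (rule square_summable_if_L2_set_le; blast)+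
qed

section \<open>Left translations\<close>

context group
begin

lemma left_regular_mult:
  assumes "g \<in> carrier G" "h \<in> carrier G"
  shows "left_regular G (g \<otimes> h) f = left_regular G g (left_regular G h f)"
  using assms by (auto simp: left_regular_def fun_eq_iff inv_mult_group m_assoc)

lemma left_regular_one:
  assumes "f \<in> ell2 (carrier G)"
  shows "left_regular G \<one> f = f"
  using assms by (auto simp: left_regular_def ell2_def fun_eq_iff)

text \<open>Keeping a subset \<open>A\<close> in place of the whole group is what later gives the translation
invariance of the limiting mean.\<close>

lemma ell2_norm_left_regular:
  assumes "g \<in> carrier G" "A \<subseteq> carrier G" "square_summable A f"
  shows "square_summable (g <# A) (left_regular G g f)"
    and "ell2_norm (g <# A) (left_regular G g f) = ell2_norm A f"
proof -
  have coset: "g <# A = (\<lambda>h. g \<otimes> h) ` A"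
    by (auto simp: l_coset_def)
  have inj: "inj_on (\<lambda>h. g \<otimes> h) A"
    using inj_on_cmult[OF assms(1)] assms(2) by (rule inj_on_subset)
  have eval: "left_regular G g f (g \<otimes> h) = f h" if "h \<in> A" for h
    using assms that by (auto simp: left_regular_def m_assoc[symmetric])
  show "square_summable (g <# A) (left_regular G g f)"
    unfolding coset summable_on_reindex[OF inj]
    using assms(3) by (rule summable_on_cong[THEN iffD1, rotated]) (simp add: eval)
  show "ell2_norm (g <# A) (left_regular G g f) = ell2_norm A f"
    unfolding ell2_norm_def coset infsum_reindex[OF inj]
    by (intro arg_cong[where f = sqrt] infsum_cong) (simp add: eval)
qed

lemma l_coset_carrier_self:
  assumes "g \<in> carrier G"
  shows "g <# carrier G = carrier G"
  using assms by (metis coset_join3 subgroup_self)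

lemma left_regular_ell2:
  assumes "g \<in> carrier G" "f \<in> ell2 (carrier G)"
  shows "left_regular G g f \<in> ell2 (carrier G)"
    and "ell2_norm (carrier G) (left_regular G g f) = ell2_norm (carrier G) f"
  using ell2_norm_left_regular[of g "carrier G" f] assms l_coset_carrier_self
  by (auto simp: ell2_def left_regular_def)

section \<open>Markov operators\<close>

text \<open>The Markov operator without its factor \<open>1 / card S\<close>: the unnormalised operator is additive over
disjoint unions, so different sets can be compared through it.\<close>

definition translate_sum :: "'a set \<Rightarrow> ('a \<Rightarrow> complex) \<Rightarrow> ('a \<Rightarrow> complex)" where
  "translate_sum S f = (\<lambda>x. \<Sum>s\<in>S. left_regular G s f x)"

lemma markov_lookup:
  assumes "finite S"
  shows "Poly_Mapping.lookup (markov S) g = (if g \<in> S then 1 / of_nat (card S) else 0)"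
  using assms by (simp add: markov_def lookup_sum lookup_single when_def)

lemma group_ring_op_markov:
  assumes "finite S"
  shows "group_ring_op G (markov S) f = (\<lambda>x. (1 / of_nat (card S)) * translate_sum S f x)"
proof -
  have "Poly_Mapping.keys (markov S) = S"
    using assms by (auto simp: in_keys_iff markov_lookup split: if_splits)
  then show ?thesis
    using assms by (simp add: group_ring_op_def translate_sum_def markov_lookup sum_distrib_left)
qed

lemma translate_sum_ell2:
  assumes "finite S" "S \<subseteq> carrier G" "f \<in> ell2 (carrier G)"
  shows "translate_sum S f \<in> ell2 (carrier G)"
    and "ell2_norm (carrier G) (translate_sum S f) \<le> card S * ell2_norm (carrier G) f"
proof -
  have sq: "square_summable (carrier G) (left_regular G s f)" if "s \<in> S" for s
    using left_regular_ell2(1)[of s f] assms that by (auto simp: ell2_def)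
  have norm: "ell2_norm (carrier G) (left_regular G s f) = ell2_norm (carrier G) f" if "s \<in> S" for s
    using left_regular_ell2(2)[of s f] assms that by auto
  note * = ell2_norm_sum[OF assms(1) sq]
  show "translate_sum S f \<in> ell2 (carrier G)"
    using * by (auto simp: ell2_def translate_sum_def left_regular_def)
  show "ell2_norm (carrier G) (translate_sum S f) \<le> card S * ell2_norm (carrier G) f"
    using * norm by (simp add: translate_sum_def)
qed

lemma ell2_norm_markov:
  assumes "finite S" "S \<subseteq> carrier G" "f \<in> ell2 (carrier G)"
  shows "ell2_norm (carrier G) (group_ring_op G (markov S) f)
    = ell2_norm (carrier G) (translate_sum S f) / card S"
proof -
  have "square_summable (carrier G) (translate_sum S f)"
    using translate_sum_ell2(1)[OF assms] by (simp add: ell2_def)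
  from ell2_norm_scale(2)[OF this, of "1 / of_nat (card S)"] show ?thesis
    by (simp add: group_ring_op_markov[OF assms(1)] norm_divide)
qed

lemma zero_in_ell2: "(\<lambda>x. 0) \<in> {f \<in> ell2 X. ell2_norm X f \<le> 1}"
  by (simp add: ell2_def ell2_norm_def)

lemma spectral_radius_le:
  fixes c :: real
  assumes "finite S" "S \<noteq> {}" "S \<subseteq> carrier G"
    and "\<And>f. f \<in> ell2 (carrier G) \<Longrightarrow> ell2_norm (carrier G) f \<le> 1 \<Longrightarrow>
      ell2_norm (carrier G) (translate_sum S f) \<le> c * card S"
  shows "spectral_radius G S \<le> c"
  unfolding spectral_radius_def group_ring_norm_def ell2_opnorm_def
proof (rule cSUP_least)
  fix f assume f: "f \<in> {f \<in> ell2 (carrier G). ell2_norm (carrier G) f \<le> 1}"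
  have "0 < card S" using assms by (simp add: card_gt_0_iff)
  with f assms show "ell2_norm (carrier G) (group_ring_op G (markov S) f) \<le> c"
    by (simp add: ell2_norm_markov pos_divide_le_eq)
qed (use zero_in_ell2 in blast)

lemma ell2_norm_translate_sum_unit_le:
  assumes "finite S" "S \<noteq> {}" "S \<subseteq> carrier G"
    and "f \<in> ell2 (carrier G)" "ell2_norm (carrier G) f \<le> 1"
  shows "ell2_norm (carrier G) (translate_sum S f) \<le> card S * spectral_radius G S"
proof -
  have pos: "0 < card S" using assms by (simp add: card_gt_0_iff)
  have "ell2_norm (carrier G) (group_ring_op G (markov S) f) \<le> spectral_radius G S"
    unfolding spectral_radius_def group_ring_norm_def ell2_opnorm_def
  proof (rule cSUP_upper)
    show "bdd_above ((\<lambda>f. ell2_norm (carrier G) (group_ring_op G (markov S) f)) `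
      {f \<in> ell2 (carrier G). ell2_norm (carrier G) f \<le> 1})"
    proof (rule bdd_aboveI2)
      fix f assume f: "f \<in> {f \<in> ell2 (carrier G). ell2_norm (carrier G) f \<le> 1}"
      have "ell2_norm (carrier G) (translate_sum S f) \<le> card S * ell2_norm (carrier G) f"
        using f assms by (intro translate_sum_ell2) auto
      also have "\<dots> \<le> real (card S) * 1"
        using f by (intro mult_left_mono) auto
      finally show "ell2_norm (carrier G) (group_ring_op G (markov S) f) \<le> 1"
        using f assms pos by (simp add: ell2_norm_markov pos_divide_le_eq)
    qed
  qed (use assms in simp)
  then show ?thesis
    using assms pos by (simp add: ell2_norm_markov pos_divide_le_eq mult.commute)
qed

lemma spectral_radius_nonneg:
  assumes "finite S" "S \<noteq> {}" "S \<subseteq> carrier G"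
  shows "0 \<le> spectral_radius G S"
proof -
  have "0 \<le> card S * spectral_radius G S"
    using ell2_norm_translate_sum_unit_le[OF assms, of "\<lambda>x. 0"] zero_in_ell2[of "carrier G"]
      ell2_norm_nonneg order_trans by blast
  moreover have "0 < card S" using assms by (simp add: card_gt_0_iff)
  ultimately show ?thesis by (simp add: zero_le_mult_iff)
qed

lemma translate_sum_scale:
  "translate_sum S (\<lambda>x. c * f x) = (\<lambda>x. c * translate_sum S f x)"
  by (simp add: translate_sum_def left_regular_def sum_distrib_left fun_eq_iff if_distrib cong: if_cong)

lemma ell2_norm_translate_sum_le:
  assumes "finite S" "S \<noteq> {}" "S \<subseteq> carrier G" "f \<in> ell2 (carrier G)"
  shows "ell2_norm (carrier G) (translate_sum S f)
    \<le> card S * spectral_radius G S * ell2_norm (carrier G) f"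
proof (cases "ell2_norm (carrier G) f = 0")
  case True
  then show ?thesis
    using translate_sum_ell2(2)[OF assms(1,3,4)] by simp
next
  case False
  define r where "r = ell2_norm (carrier G) f"
  have r: "0 < r" using False ell2_norm_nonneg[of "carrier G" f] by (simp add: r_def)
  have f: "square_summable (carrier G) f" using assms by (simp add: ell2_def)
  have Tf: "square_summable (carrier G) (translate_sum S f)"
    using translate_sum_ell2(1)[OF assms(1,3,4)] by (simp add: ell2_def)
  define u where "u = (\<lambda>x. of_real (1 / r) * f x)"
  have "u \<in> ell2 (carrier G)"
    using ell2_norm_scale(1)[OF f, of "of_real (1/r)"] assms(4) unfolding u_def by (simp add: ell2_def)
  moreover have "ell2_norm (carrier G) u \<le> 1"
    using ell2_norm_scale(2)[OF f, of "of_real (1/r)"] r unfolding u_def r_def[symmetric] by (simp add: norm_divide)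
  ultimately have "ell2_norm (carrier G) (translate_sum S u) \<le> card S * spectral_radius G S"
    using assms by (intro ell2_norm_translate_sum_unit_le)
  moreover have "ell2_norm (carrier G) (translate_sum S u) = ell2_norm (carrier G) (translate_sum S f) / r"
    using r unfolding u_def translate_sum_scale ell2_norm_scale(2)[OF Tf] by (simp add: norm_divide)
  ultimately show ?thesis
    using r by (simp add: pos_divide_le_eq r_def)
qed

text \<open>Apply the operator to the point mass at \<open>\<one>\<close>: the result is \<open>1\<close> on all of \<open>S\<close>, so its norm is at
least \<open>sqrt (card S)\<close>. A set of small spectral radius is therefore large.\<close>

lemma inverse_card_le_spectral_radius_squared:
  assumes "finite S" "S \<noteq> {}" "S \<subseteq> carrier G"
  shows "1 / card S \<le> (spectral_radius G S)\<^sup>2"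
proof -
  define \<delta> :: "'a \<Rightarrow> complex" where "\<delta> = indicator {\<one>}"
  have sum_delta: "(\<Sum>x\<in>F. (cmod (\<delta> x))\<^sup>2) \<le> 1" if "finite F" for F
  proof -
    have "(\<Sum>x\<in>F. (cmod (\<delta> x))\<^sup>2) = (\<Sum>x\<in>F. if x = \<one> then 1 else 0)"
      by (rule sum.cong) (auto simp: \<delta>_def)
    then show ?thesis using that by simp
  qed
  then have L2: "L2_set (\<lambda>x. cmod (\<delta> x)) F \<le> 1" if "finite F" for F
    using that by (simp add: L2_set_def)
  have delta: "\<delta> \<in> ell2 (carrier G)" "ell2_norm (carrier G) \<delta> \<le> 1"
    using square_summable_if_L2_set_le[of "carrier G" \<delta> 1] L2 by (auto simp: ell2_def \<delta>_def indicator_def)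
  have eval: "translate_sum S \<delta> x = 1" if "x \<in> S" for x
  proof -
    have "left_regular G s \<delta> x = (if s = x then 1 else 0)" if "s \<in> S" for s
      using left_regular_delta[of s "\<one>"] that assms unfolding \<delta>_def
      by (auto simp: subset_iff indicator_def)
    then show ?thesis using that assms by (simp add: translate_sum_def)
  qed
  have "square_summable (carrier G) (translate_sum S \<delta>)"
    using translate_sum_ell2(1)[OF assms(1,3) delta(1)] by (simp add: ell2_def)
  then have "L2_set (\<lambda>x. cmod (translate_sum S \<delta> x)) S \<le> ell2_norm (carrier G) (translate_sum S \<delta>)"
    using assms by (intro L2_set_le_ell2_norm)
  also have "\<dots> \<le> card S * spectral_radius G S"
    using assms delta by (intro ell2_norm_translate_sum_unit_le)
  finally have "sqrt (card S) \<le> card S * spectral_radius G S"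
    using eval by (simp add: L2_set_def)
  then have "card S \<le> (card S * spectral_radius G S)\<^sup>2"
    using real_sqrt_ge_zero by (metis of_nat_0_le_iff power_mono real_sqrt_pow2)
  moreover have "0 < card S" using assms by (simp add: card_gt_0_iff)
  ultimately show ?thesis
    by (simp add: power_mult_distrib power2_eq_square field_simps)
qed

section \<open>Products of words\<close>

definition words :: "'a set \<Rightarrow> nat \<Rightarrow> 'a list set" where
  "words S k = {w. set w \<subseteq> S \<and> length w = k}"

abbreviation word_prod :: "'a list \<Rightarrow> 'a" where
  "word_prod w \<equiv> foldr (\<otimes>) w \<one>"

definition word_count :: "'a set \<Rightarrow> nat \<Rightarrow> 'a \<Rightarrow> nat" where
  "word_count S k g = card {w \<in> words S k. word_prod w = g}"

lemma finite_words: "finite S \<Longrightarrow> finite (words S k)"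
  by (simp add: words_def finite_lists_length_eq)

lemma card_words: "finite S \<Longrightarrow> card (words S k) = card S ^ k"
  by (simp add: words_def card_lists_length_eq)

lemma set_pow_eq: "set_pow G S k = word_prod ` words S k"
  by (auto simp: set_pow_def words_def)

lemma words_Suc: "words S (Suc k) = (\<lambda>(s, w). s # w) ` (S \<times> words S k)"
  by (auto simp: words_def length_Suc_conv image_iff)

lemma word_prod_closed: "set w \<subseteq> carrier G \<Longrightarrow> word_prod w \<in> carrier G"
  by (induction w) auto

lemma word_prod_append:
  assumes "set v \<subseteq> carrier G" "set w \<subseteq> carrier G"
  shows "word_prod (v @ w) = word_prod v \<otimes> word_prod w"
  using assms by (induction v) (auto simp: m_assoc word_prod_closed)

lemma word_prod_rev_inv:
  assumes "set w \<subseteq> carrier G"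
  shows "word_prod (rev (map (\<lambda>s. inv s) w)) = inv (word_prod w)"
  using assms
proof (induction w)
  case (Cons s w)
  have "set (rev (map (\<lambda>s. inv s) w)) \<subseteq> carrier G" using Cons.prems by auto
  then show ?case
    using Cons by (simp add: word_prod_append inv_mult_group word_prod_closed del: foldr_append)
qed simp

lemma set_pow_carrier: "S \<subseteq> carrier G \<Longrightarrow> set_pow G S k \<subseteq> carrier G"
  by (auto simp: set_pow_eq words_def intro!: word_prod_closed)

lemma sum_word_count:
  assumes "finite S"
  shows "(\<Sum>g\<in>set_pow G S k. of_nat (word_count S k g) * h g)
    = (\<Sum>w\<in>words S k. h (word_prod w) :: 'c :: comm_semiring_1)"
proof -
  have "(\<Sum>w\<in>words S k. h (word_prod w))
    = (\<Sum>g\<in>set_pow G S k. \<Sum>w\<in>{w \<in> words S k. word_prod w = g}. h (word_prod w))"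
    using assms by (intro sum.group[symmetric]) (auto simp: set_pow_eq finite_words)
  also have "\<dots> = (\<Sum>g\<in>set_pow G S k. of_nat (word_count S k g) * h g)"
    by (intro sum.cong) (simp_all add: word_count_def)
  finally show ?thesis by simp
qed

text \<open>Inverting the letters of a word and reversing their order is an involution that exchanges the
representations of \<open>g\<close> with those of \<open>inv g\<close>.\<close>

lemma word_count_inv:
  assumes "symmetric_subset G S" "g \<in> carrier G"
  shows "word_count S k (inv g) = word_count S k g"
proof -
  let ?W = "\<lambda>g. {w \<in> words S k. word_prod w = g}"
  let ?r = "\<lambda>w. rev (map (\<lambda>s. inv s) w)"
  have S: "S \<subseteq> carrier G" "\<And>s. s \<in> S \<Longrightarrow> inv s \<in> S"
    using assms(1) by (auto simp: symmetric_subset_def)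
  have "bij_betw ?r (?W g) (?W (inv g))"
  proof (rule bij_betw_byWitness[where f' = ?r])
    have "map ((\<lambda>s. inv s) \<circ> (\<lambda>s. inv s)) w = w" if "set w \<subseteq> S" for w
      using that S(1) by (induction w) auto
    then show "\<forall>w\<in>?W g. ?r (?r w) = w" "\<forall>w\<in>?W (inv g). ?r (?r w) = w"
      by (auto simp: words_def rev_map)
    have "word_prod (?r w) = inv (word_prod w)" if "w \<in> words S k" for w
      using that S(1) by (intro word_prod_rev_inv) (auto simp: words_def)
    then show "?r ` ?W g \<subseteq> ?W (inv g)" "?r ` ?W (inv g) \<subseteq> ?W g"
      using S(2) assms(2) by (auto simp: words_def subset_iff)
  qed
  from bij_betw_same_card[OF this] show ?thesis
    by (simp add: word_count_def)
qed

text \<open>The \<open>k\<close>-th power of the operator is the sum of the translations by all words of length \<open>k\<close>, so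
up to scaling \<^const>\<open>word_count\<close> is the \<open>k\<close>-fold convolution power of the uniform measure on \<open>S\<close>.\<close>

lemma translate_sum_power:
  assumes "finite S" "S \<subseteq> carrier G" "f \<in> ell2 (carrier G)"
  shows "(translate_sum S ^^ k) f x = (\<Sum>w\<in>words S k. left_regular G (word_prod w) f x)"
proof (induction k arbitrary: x)
  case 0
  have "words S 0 = {[]}" by (auto simp: words_def)
  then show ?case using assms(3) by (simp add: left_regular_one)
next
  case (Suc k)
  have "(translate_sum S ^^ k) f = (\<lambda>y. \<Sum>w\<in>words S k. left_regular G (word_prod w) f y)"
    by (rule ext) (rule Suc)
  then have "(translate_sum S ^^ Suc k) f x
    = (\<Sum>s\<in>S. left_regular G s (\<lambda>y. \<Sum>w\<in>words S k. left_regular G (word_prod w) f y) x)"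
    by (simp add: translate_sum_def)
  also have "\<dots> = (\<Sum>s\<in>S. \<Sum>w\<in>words S k. left_regular G s (left_regular G (word_prod w) f) x)"
    by (intro sum.cong refl) (simp add: left_regular_def)
  also have "\<dots> = (\<Sum>s\<in>S. \<Sum>w\<in>words S k. left_regular G (word_prod (s # w)) f x)"
  proof (intro sum.cong refl)
    fix s w assume "s \<in> S" "w \<in> words S k"
    then have "s \<in> carrier G" "word_prod w \<in> carrier G"
      using assms(2) by (auto simp: words_def intro!: word_prod_closed)
    then show "left_regular G s (left_regular G (word_prod w) f) x
        = left_regular G (word_prod (s # w)) f x"
      by (simp add: left_regular_mult)
  qed
  also have "\<dots> = (\<Sum>(s, w)\<in>S \<times> words S k. left_regular G (word_prod (s # w)) f x)"
    by (simp add: sum.cartesian_product)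
  also have "\<dots> = (\<Sum>w\<in>words S (Suc k). left_regular G (word_prod w) f x)"
    unfolding words_Suc by (subst sum.reindex) (auto simp: inj_on_def case_prod_beta)
  finally show ?case .
qed

lemma ell2_norm_translate_sum_power_le:
  assumes "finite S" "S \<noteq> {}" "S \<subseteq> carrier G" "f \<in> ell2 (carrier G)"
  shows "(translate_sum S ^^ k) f \<in> ell2 (carrier G)
    \<and> ell2_norm (carrier G) ((translate_sum S ^^ k) f)
      \<le> (card S * spectral_radius G S) ^ k * ell2_norm (carrier G) f"
proof (induction k)
  case (Suc k)
  let ?f = "(translate_sum S ^^ k) f"
  have "ell2_norm (carrier G) (translate_sum S ?f)
      \<le> card S * spectral_radius G S * ell2_norm (carrier G) ?f"
    using assms Suc by (intro ell2_norm_translate_sum_le) auto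
  also have "\<dots> \<le> card S * spectral_radius G S
      * ((card S * spectral_radius G S) ^ k * ell2_norm (carrier G) f)"
    using Suc spectral_radius_nonneg[OF assms(1-3)] by (intro mult_left_mono) auto
  finally show ?case
    using translate_sum_ell2(1)[OF assms(1,3)] Suc by (simp add: mult.assoc)
qed (use assms in simp)

text \<open>Operators with nonnegative coefficients have norms that are monotone in the coefficients, because
on replacing \<open>f\<close> by its absolute value the pointwise values dominate. The indicator function of \<open>L\<close> is at
most \<open>1 / t\<close> times the word count, whose operator is the \<open>k\<close>-th power of that of \<open>S\<close>.\<close>

lemma spectral_radius_level_set_le:
  assumes "finite S" "S \<noteq> {}" "S \<subseteq> carrier G"
    and "L \<subseteq> set_pow G S k" "L \<noteq> {}" "0 < t" "\<And>g. g \<in> L \<Longrightarrow> t \<le> word_count S k g"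
  shows "spectral_radius G L \<le> (card S * spectral_radius G S) ^ k / (real t * card L)"
proof (rule spectral_radius_le)
  have finP: "finite (set_pow G S k)"
    using assms(1) by (simp add: set_pow_eq finite_words)
  show finL: "finite L" and "L \<noteq> {}" and LG: "L \<subseteq> carrier G"
    using finP assms(4,5) set_pow_carrier[OF assms(3)] by (auto intro: finite_subset)
  fix f assume f: "f \<in> ell2 (carrier G)" "ell2_norm (carrier G) f \<le> 1"
  define F :: "'a \<Rightarrow> complex" where "F = (\<lambda>x. of_real (cmod (f x)))"
  have F: "F \<in> ell2 (carrier G)" "ell2_norm (carrier G) F = ell2_norm (carrier G) f"
    using f(1) by (auto simp: F_def ell2_def ell2_norm_def)
  note TF = ell2_norm_translate_sum_power_le[OF assms(1-3) F(1), of k]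
  have pointwise: "cmod (translate_sum L f x) \<le> (1 / t) * cmod ((translate_sum S ^^ k) F x)" for x
  proof -
    define a where "a g = cmod (left_regular G g f x)" for g
    have a0: "0 \<le> a g" for g by (simp add: a_def)
    have Fa: "left_regular G g F x = of_real (a g)" for g
      by (simp add: a_def F_def left_regular_def)
    have "real t * cmod (translate_sum L f x) \<le> real t * (\<Sum>g\<in>L. a g)"
      unfolding translate_sum_def a_def by (intro mult_left_mono norm_sum) simp
    also have "\<dots> \<le> (\<Sum>g\<in>L. word_count S k g * a g)"
      unfolding sum_distrib_left using assms(7) a0 by (intro sum_mono mult_right_mono) auto
    also have "\<dots> \<le> (\<Sum>g\<in>set_pow G S k. word_count S k g * a g)"
      using finP assms(4) a0 by (intro sum_mono2) auto
    also have "\<dots> = (\<Sum>w\<in>words S k. a (word_prod w))"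
      by (rule sum_word_count[OF assms(1)])
    also have "\<dots> = cmod (of_real \<dots>)"
      using a0 by (simp add: sum_nonneg del: of_real_sum)
    also have "of_real (\<Sum>w\<in>words S k. a (word_prod w)) = (translate_sum S ^^ k) F x"
      by (simp add: translate_sum_power[OF assms(1,3) F(1)] Fa)
    finally show ?thesis
      using assms(6) by (simp add: field_simps)
  qed
  have "ell2_norm (carrier G) (translate_sum L f)
      \<le> (1 / t) * ell2_norm (carrier G) ((translate_sum S ^^ k) F)"
    using TF by (intro ell2_norm_mono(2) pointwise) (auto simp: ell2_def)
  also have "\<dots> \<le> (1 / t) * ((card S * spectral_radius G S) ^ k * 1)"
  proof (intro mult_left_mono)
    have "0 \<le> (card S * spectral_radius G S) ^ k"
      using spectral_radius_nonneg[OF assms(1-3)] by simp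
    then have "(card S * spectral_radius G S) ^ k * ell2_norm (carrier G) F
        \<le> (card S * spectral_radius G S) ^ k * 1"
      using F(2) f(2) by (intro mult_left_mono) simp_all
    with TF show "ell2_norm (carrier G) ((translate_sum S ^^ k) F) \<le> (card S * spectral_radius G S) ^ k * 1"
      by linarith
  qed simp
  also have "\<dots> = (card S * spectral_radius G S) ^ k / (real t * card L) * card L"
    using finL assms(5) by (simp add: card_eq_0_iff)
  finally show "ell2_norm (carrier G) (translate_sum L f)
    \<le> (card S * spectral_radius G S) ^ k / (real t * card L) * card L" .
qed

end

section \<open>Superlevel sets of the word count\<close>

text \<open>If the values of \<open>p\<close> are listed in decreasing order, the \<open>i\<close>-th one is at most \<open>c / i\<close>, since its
superlevel set has at least \<open>i\<close> elements. The sum is therefore bounded by a harmonic sum. The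
induction removes a smallest value in each step.\<close>

lemma sum_le_harm:
  fixes p :: "'i \<Rightarrow> real"
  assumes "finite A" "\<And>a. a \<in> A \<Longrightarrow> 0 \<le> p a"
    and "\<And>a. a \<in> A \<Longrightarrow> p a * card {b \<in> A. p a \<le> p b} \<le> c"
  shows "sum p A \<le> c * harm (card A)"
  using assms
proof (induction A rule: finite_psubset_induct)
  case (psubset A)
  show ?case
  proof (cases "A = {}")
    case True
    then show ?thesis by (simp add: harm_def)
  next
    case False
    \<comment> \<open>The level set of a smallest value is the whole of \<open>A\<close>.\<close>
    obtain a where a: "a \<in> A" "\<And>b. b \<in> A \<Longrightarrow> p a \<le> p b"
      using ex_is_arg_min_if_finite[of A p] psubset.hyps False by (auto simp: is_arg_min_linorder)
    have "p a * card A \<le> c"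
    proof -
      have "{b \<in> A. p a \<le> p b} = A" using a by auto
      then show ?thesis using psubset.prems(2)[OF a(1)] by simp
    qed
    moreover have "0 < card A" using psubset.hyps False by (simp add: card_gt_0_iff)
    ultimately have "p a \<le> c * inverse (card A)"
      by (simp add: field_simps)
    moreover have "sum p (A - {a}) \<le> c * harm (card (A - {a}))"
    proof (rule psubset.IH)
      fix b assume b: "b \<in> A - {a}"
      have "p b * card {x \<in> A - {a}. p b \<le> p x} \<le> p b * card {x \<in> A. p b \<le> p x}"
        using psubset.hyps psubset.prems(1) b by (intro mult_left_mono) (auto intro!: card_mono)
      also have "\<dots> \<le> c" using psubset.prems(2) b by blast
      finally show "p b * card {x \<in> A - {a}. p b \<le> p x} \<le> c" .
    qed (use a psubset.prems in auto)
    moreover have "harm (card A) = harm (card (A - {a})) + inverse (real (card A))"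
      using a(1) psubset.hyps by (metis card.remove harm_Suc)
    ultimately show ?thesis
      using a(1) psubset.hyps by (simp add: sum.remove algebra_simps)
  qed
qed

lemma harm_le_one_plus_ln:
  assumes "0 < n"
  shows "harm n \<le> 1 + ln (real n)"
proof -
  obtain m where "n = Suc m" using assms by (metis gr0_implies_Suc)
  then show ?thesis
    using decseqD[OF decseq_harm_diff_ln, of 0 m] by (simp add: harm_def)
qed

context group
begin

text \<open>Among the superlevel sets of the word count choose the one for which the product of level and
cardinality is largest. All \<open>card S ^ k\<close> words are counted, so by \<open>sum_le_harm\<close> this product is at
least \<open>card S ^ k\<close> divided by a harmonic number, which grows at most linearly in \<open>k\<close>. This is exactly the
loss when the \<open>k\<close>-th power is replaced by a uniform measure.\<close>

theorem exists_level_set: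
  assumes "finite S" "S \<noteq> {}" "symmetric_subset G S"
  shows "\<exists>L. L \<noteq> {} \<and> L \<subseteq> set_pow G S k \<and> symmetric_subset G L \<and>
    spectral_radius G L \<le> (1 + real k * ln (card S)) * spectral_radius G S ^ k"
proof -
  let ?P = "set_pow G S k" and ?n = "card S"
  let ?N = "\<lambda>g. real (word_count S k g)"
  let ?L = "\<lambda>a. {b \<in> ?P. ?N a \<le> ?N b}"
  have S: "S \<subseteq> carrier G" and S_inv: "\<And>s. s \<in> S \<Longrightarrow> inv s \<in> S"
    using assms(3) by (auto simp: symmetric_subset_def)
  have n: "0 < ?n" using assms by (simp add: card_gt_0_iff)
  have W: "finite (words S k)" "card (words S k) = ?n ^ k" "words S k \<noteq> {}"
    using assms(1) n card_words[OF assms(1), of k] by (auto simp: finite_words)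
  have P: "finite ?P" "?P \<noteq> {}" "card ?P \<le> ?n ^ k" "?P \<subseteq> carrier G"
    using W card_image_le[OF W(1), of word_prod] set_pow_carrier[OF S] by (auto simp: set_pow_eq)
  obtain a where a: "a \<in> ?P" "\<And>b. b \<in> ?P \<Longrightarrow> ?N b * card (?L b) \<le> ?N a * card (?L a)"
    using ex_is_arg_min_if_finite[of ?P "\<lambda>b. - (?N b * card (?L b))"] P(1,2)
    by (auto simp: is_arg_min_linorder simp del: of_nat_mult)
  have "real (?n ^ k) = sum ?N ?P"
    using sum_word_count[OF assms(1), of k "\<lambda>_. 1 :: real"] W(2) by simp
  also have "\<dots> \<le> ?N a * card (?L a) * harm (card ?P)"
    using P(1) a by (intro sum_le_harm) auto
  finally have total: "real (?n ^ k) \<le> ?N a * card (?L a) * harm (card ?P)" .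
  have Na: "0 < word_count S k a"
  proof (rule ccontr)
    assume "\<not> 0 < word_count S k a"
    with total have "real (?n ^ k) \<le> 0" by simp
    moreover have "0 < real (?n ^ k)" using n by simp
    ultimately show False by linarith
  qed
  have La: "0 < card (?L a)" using a(1) P(1) by (auto simp: card_gt_0_iff)
  have "harm (card ?P) \<le> 1 + ln (card ?P)"
    using P(1,2) by (intro harm_le_one_plus_ln) (simp add: card_gt_0_iff)
  also have "ln (real (card ?P)) \<le> ln (real (?n ^ k))"
    using P(1,2,3) n by (subst ln_le_cancel_iff) (auto simp: card_gt_0_iff simp del: of_nat_power)
  also have "ln (real (?n ^ k)) = k * ln ?n"
    using n by (simp add: ln_realpow)
  finally have harm: "harm (card ?P) \<le> 1 + k * ln ?n" by simp
  have "spectral_radius G (?L a) \<le> (?n * spectral_radius G S) ^ k / (?N a * card (?L a))"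
    using a(1) Na assms S by (intro spectral_radius_level_set_le) auto
  also have "\<dots> = real (?n ^ k) / (?N a * card (?L a)) * spectral_radius G S ^ k"
    by (simp add: power_mult_distrib)
  also have "\<dots> \<le> harm (card ?P) * spectral_radius G S ^ k"
    using total Na La spectral_radius_nonneg[OF assms(1,2) S]
    by (intro mult_right_mono) (simp_all add: pos_divide_le_eq mult.commute)
  also have "\<dots> \<le> (1 + k * ln ?n) * spectral_radius G S ^ k"
    using harm spectral_radius_nonneg[OF assms(1,2) S] by (intro mult_right_mono) auto
  finally have bound: "spectral_radius G (?L a) \<le> (1 + k * ln ?n) * spectral_radius G S ^ k" .
  have "inv g \<in> ?P" if g: "g \<in> ?P" for g
  proof -
    obtain w where w: "set w \<subseteq> S" "length w = k" "g = word_prod w"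
      using g by (auto simp: set_pow_eq words_def)
    then have "inv g = word_prod (rev (map (\<lambda>s. inv s) w))"
      using word_prod_rev_inv S by auto
    moreover have "rev (map (\<lambda>s. inv s) w) \<in> words S k"
      using w S_inv by (auto simp: words_def)
    ultimately show ?thesis by (auto simp: set_pow_eq)
  qed
  then have "symmetric_subset G (?L a)"
    using P(4) word_count_inv[OF assms(3)] by (auto simp: symmetric_subset_def subset_iff)
  then show ?thesis
    using bound a(1) by (intro exI[of _ "?L a"]) auto
qed

end

section \<open>Kesten's criterion\<close>

text \<open>A substitute for an ultrafilter limit: by the theorem of Tychonoff the cube of all functions into
the unit interval is compact, so the sequence has a cluster point \<open>\<mu>\<close>. The filter \<open>F\<close> collects the
indices at which the sequence is close to \<open>\<mu>\<close>, and it serves all coordinates at once.\<close>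

lemma bounded_family_converges_along_filter:
  fixes \<nu> :: "nat \<Rightarrow> 'i \<Rightarrow> real"
  assumes "\<And>n i. \<nu> n i \<in> {0..1}"
  obtains F \<mu> where "F \<noteq> bot" "F \<le> sequentially" "\<And>i. ((\<lambda>n. \<nu> n i) \<longlongrightarrow> \<mu> i) F"
proof -
  define K :: "('i \<Rightarrow> real) set" where "K = PiE UNIV (\<lambda>_. {0..1})"
  have "compactin (product_topology (\<lambda>_. euclidean) UNIV) K"
    unfolding K_def by (simp add: compactin_PiE)
  then have "compact K"
    by (simp add: euclidean_product_topology)
  moreover have "eventually (\<lambda>x. x \<in> K) (filtermap \<nu> sequentially)"
    using assms by (simp add: eventually_filtermap K_def PiE_UNIV_domain)
  moreover have "filtermap \<nu> sequentially \<noteq> bot"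
    by (simp add: filtermap_bot_iff)
  ultimately obtain \<mu> where \<mu>: "inf (nhds \<mu>) (filtermap \<nu> sequentially) \<noteq> bot"
    unfolding compact_filter by blast
  define F where "F = inf sequentially (filtercomap \<nu> (nhds \<mu>))"
  have "F \<noteq> bot"
  proof
    assume "F = bot"
    then have "eventually (\<lambda>_. False) F" by simp
    then obtain P Q where P: "eventually P sequentially" and Q: "eventually Q (nhds \<mu>)"
      and disjoint: "\<And>n. P n \<Longrightarrow> Q (\<nu> n) \<Longrightarrow> False"
      unfolding F_def eventually_inf eventually_filtercomap by metis
    have "eventually (\<lambda>x. \<not> Q x) (filtermap \<nu> sequentially)"
      unfolding eventually_filtermap using P by (rule eventually_mono) (use disjoint in blast)
    with Q have "eventually (\<lambda>_. False) (inf (nhds \<mu>) (filtermap \<nu> sequentially))"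
      unfolding eventually_inf by blast
    with \<mu> show False by (simp add: trivial_limit_def)
  qed
  moreover have "F \<le> sequentially" by (simp add: F_def)
  moreover have "((\<lambda>n. \<nu> n i) \<longlongrightarrow> \<mu> i) F" for i
  proof -
    have "(\<nu> \<longlongrightarrow> \<mu>) F"
      unfolding F_def filterlim_iff_le_filtercomap by simp
    then show ?thesis
      using continuous_on_tendsto_compose[OF continuous_on_product_coordinates] by fastforce
  qed
  ultimately show thesis using that by blast
qed

context group
begin

text \<open>The norm of a sum of \<open>card S\<close> vectors of norm at most \<open>1\<close> can only be close to \<open>card S\<close> if any two of
the summands add up to a vector of norm close to \<open>2\<close>. By the parallelogram law these two summands
are then close to each other. As \<open>\<one> \<in> S\<close>, one of them may be taken to be \<open>f\<close> itself.\<close>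

lemma translate_sum_almost_invariant:
  fixes \<delta> :: real
  assumes "finite S" "S \<subseteq> carrier G" "\<one> \<in> S" "s \<in> S"
    and "f \<in> ell2 (carrier G)" "ell2_norm (carrier G) f \<le> 1" "0 \<le> \<delta>"
    and "card S * (1 - \<delta>) \<le> ell2_norm (carrier G) (translate_sum S f)"
  shows "(ell2_norm (carrier G) (\<lambda>x. f x - left_regular G s f x))\<^sup>2 \<le> 4 * real (card S) * \<delta>"
proof (cases "s = \<one>")
  case True
  then show ?thesis
    using assms by (simp add: left_regular_one ell2_norm_def)
next
  case False
  let ?norm = "ell2_norm (carrier G)" and ?n = "real (card S)"
  let ?sf = "left_regular G s f" and ?R = "S - {\<one>, s}"
  have f: "square_summable (carrier G) f" and sf: "square_summable (carrier G) ?sf"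
    and norm_sf: "?norm ?sf = ?norm f"
    using assms left_regular_ell2[of s f] by (auto simp: ell2_def)
  have R: "finite ?R" "?R \<subseteq> carrier G" using assms by auto
  have card_R: "real (card ?R) = ?n - 2"
  proof -
    have "card {\<one>, s} \<le> card S" using assms by (intro card_mono) auto
    then show ?thesis
      using assms False by (simp add: card_Diff_subset of_nat_diff)
  qed
  have Rf: "square_summable (carrier G) (translate_sum ?R f)"
    using translate_sum_ell2(1)[OF R assms(5)] by (simp add: ell2_def)
  have "translate_sum S f x = (f x + ?sf x) + translate_sum ?R f x" for x
  proof -
    have "translate_sum S f x = translate_sum {\<one>, s} f x + translate_sum ?R f x"
      unfolding translate_sum_def using assms by (subst sum.subset_diff[of "{\<one>, s}" S]) auto
    then show ?thesis
      using False assms(5) by (simp add: translate_sum_def left_regular_one)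
  qed
  then have "translate_sum S f = (\<lambda>x. (f x + ?sf x) + translate_sum ?R f x)" by (rule ext)
  then have "?norm (translate_sum S f) \<le> ?norm (\<lambda>x. f x + ?sf x) + ?norm (translate_sum ?R f)"
    using ell2_norm_triangle(2)[OF ell2_norm_triangle(1)[OF f sf] Rf] by simp
  moreover have "?norm (translate_sum ?R f) \<le> ?n - 2"
  proof -
    have "?norm (translate_sum ?R f) \<le> card ?R * ?norm f"
      by (rule translate_sum_ell2(2)[OF R assms(5)])
    also have "\<dots> \<le> real (card ?R) * 1" using assms(6) by (intro mult_left_mono) auto
    finally show ?thesis using card_R by simp
  qed
  ultimately have sum_large: "2 - ?n * \<delta> \<le> ?norm (\<lambda>x. f x + ?sf x)"
    using assms(8) by (simp add: algebra_simps)
  have "4 - 4 * (?n * \<delta>) \<le> (?norm (\<lambda>x. f x + ?sf x))\<^sup>2"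
  proof (cases "?n * \<delta> \<le> 2")
    case True
    have "4 - 4 * (?n * \<delta>) \<le> (2 - ?n * \<delta>)\<^sup>2" by (simp add: power2_diff)
    also have "\<dots> \<le> (?norm (\<lambda>x. f x + ?sf x))\<^sup>2"
      using True sum_large by (intro power_mono) auto
    finally show ?thesis .
  next
    case False
    then have "4 - 4 * (?n * \<delta>) \<le> 0" by simp
    also have "0 \<le> (?norm (\<lambda>x. f x + ?sf x))\<^sup>2" by simp
    finally show ?thesis .
  qed
  moreover have "(?norm f)\<^sup>2 \<le> 1"
    using ell2_norm_nonneg assms(6) by (rule power_le_one)
  ultimately show ?thesis
    using ell2_norm_parallelogram[OF f sf] norm_sf by (simp add: mult.assoc)
qed

lemma invariant_under_generators:
  assumes "generate G S = carrier G" "S \<subseteq> carrier G"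
    and inv: "\<And>s A. s \<in> S \<Longrightarrow> A \<subseteq> carrier G \<Longrightarrow> \<mu> (s <# A) = \<mu> A"
    and "g \<in> carrier G" "A \<subseteq> carrier G"
  shows "\<mu> (g <# A) = \<mu> A"
proof -
  have "g \<in> generate G S" using assms by simp
  then show ?thesis using assms(5)
  proof (induction arbitrary: A)
    case one
    then show ?case by (simp add: lcos_mult_one)
  next
    case (incl h)
    then show ?case by (rule inv)
  next
    case (inv h)
    then have h: "h \<in> carrier G" using assms(2) by auto
    have "inv h <# A \<subseteq> carrier G" using h inv.prems by (simp add: l_coset_subset_G)
    then have "\<mu> (h <# (inv h <# A)) = \<mu> (inv h <# A)" by (intro assms(3) inv)
    then show ?case using h inv.prems by (simp add: lcos_m_assoc lcos_mult_one)
  next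
    case (eng h1 h2)
    then have h: "h1 \<in> carrier G" "h2 \<in> carrier G" using assms(1) by auto
    then have "\<mu> ((h1 \<otimes> h2) <# A) = \<mu> (h1 <# (h2 <# A))"
      using eng.prems by (simp add: lcos_m_assoc)
    also have "\<dots> = \<mu> (h2 <# A)"
      using h eng.prems by (intro eng.IH l_coset_subset_G)
    also have "\<dots> = \<mu> A" using eng.prems by (rule eng.IH)
    finally show ?case .
  qed
qed

text \<open>The squares of the absolute values of the \<open>f n\<close> are densities of almost invariant measures, and
a limit of these measures along a suitable filter is an invariant mean. The mass of \<open>A\<close> is the square of
the norm of the restriction to \<open>A\<close>, so the triangle inequality controls the effect of a
translation.\<close>

theorem amenable_if_almost_invariant_vectors:
  assumes "S \<subseteq> carrier G" "generate G S = carrier G"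
    and f: "\<And>n. f n \<in> ell2 (carrier G)" "\<And>n. ell2_norm (carrier G) (f n) \<le> 1"
    and norm_lim: "(\<lambda>n. ell2_norm (carrier G) (f n)) \<longlonglongrightarrow> 1"
    and diff_lim: "\<And>s. s \<in> S \<Longrightarrow>
      (\<lambda>n. ell2_norm (carrier G) (\<lambda>x. f n x - left_regular G s (f n) x)) \<longlonglongrightarrow> 0"
  shows "amenable G"
proof -
  define \<nu> where "\<nu> n A = (ell2_norm (A \<inter> carrier G) (f n))\<^sup>2" for n A
  have sq: "square_summable A (f n)" if "A \<subseteq> carrier G" for A n
  proof (rule ell2_norm_subset(1)[OF _ that])
    show "square_summable (carrier G) (f n)" using f(1)[of n] by (simp add: ell2_def)
  qed
  have le1: "ell2_norm A (f n) \<le> 1" if "A \<subseteq> carrier G" for A n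
    by (rule order_trans[OF ell2_norm_subset(2)[OF sq[OF order_refl] that] f(2)])
  have "\<nu> n A \<in> {0..1}" for n A
    using le1[of "A \<inter> carrier G" n] by (simp add: \<nu>_def ell2_norm_nonneg power_le_one)
  then obtain F \<mu> where F: "F \<noteq> bot" "F \<le> sequentially"
    and lim: "\<And>A. ((\<lambda>n. \<nu> n A) \<longlongrightarrow> \<mu> A) F"
    using bounded_family_converges_along_filter[of \<nu>] by blast
  have "0 \<le> \<mu> A" for A
    using F(1) by (rule tendsto_lowerbound[OF lim, rotated]) (simp add: \<nu>_def)
  moreover have "\<mu> (carrier G) = 1"
  proof -
    have "((\<lambda>n. \<nu> n (carrier G)) \<longlongrightarrow> 1\<^sup>2) F"
      unfolding \<nu>_def Int_absorb using norm_lim F(2) by (intro tendsto_power) (rule tendsto_mono)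
    then show ?thesis using tendsto_unique[OF F(1) lim] by simp
  qed
  moreover have "\<mu> (A \<union> B) = \<mu> A + \<mu> B"
    if AB: "A \<subseteq> carrier G" "B \<subseteq> carrier G" "A \<inter> B = {}" for A B
  proof -
    have "\<nu> n (A \<union> B) = \<nu> n A + \<nu> n B" for n
      using AB sq by (simp add: \<nu>_def ell2_norm_power2 Int_absorb2 infsum_Un_disjoint)
    then have "((\<lambda>n. \<nu> n (A \<union> B)) \<longlongrightarrow> \<mu> A + \<mu> B) F"
      using tendsto_add[OF lim lim] by simp
    then show ?thesis by (rule tendsto_unique[OF F(1) lim])
  qed
  moreover have gen_inv: "\<mu> (s <# A) = \<mu> A" if s: "s \<in> S" and A: "A \<subseteq> carrier G" for s A
  proof -
    let ?d = "\<lambda>n. ell2_norm (carrier G) (\<lambda>x. f n x - left_regular G s (f n) x)"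
    have sG: "s \<in> carrier G" using s assms(1) by blast
    have sA: "s <# A \<subseteq> carrier G" using sG A by (simp add: l_coset_subset_G)
    have bound: "\<bar>\<nu> n (s <# A) - \<nu> n A\<bar> \<le> 2 * ?d n" for n
    proof -
      let ?a = "ell2_norm (s <# A) (f n)" and ?b = "ell2_norm A (f n)"
      \<comment> \<open>The translate of \<open>f n\<close> has on \<open>s <# A\<close> the norm that \<open>f n\<close> has on \<open>A\<close>, so both masses can be
        compared as norms over the same set.\<close>
      note shift = ell2_norm_left_regular[OF sG A sq[OF A, of n]]
      have all: "square_summable (carrier G) (left_regular G s (f n))"
        using left_regular_ell2(1)[OF sG f(1)] by (simp add: ell2_def)
      have "\<bar>?a - ?b\<bar> \<le> ell2_norm (s <# A) (\<lambda>x. f n x - left_regular G s (f n) x)"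
        using ell2_norm_diff(2)[OF sq[OF sA] shift(1)] shift(2) by simp
      also have "\<dots> \<le> ?d n"
        using ell2_norm_diff(1)[OF sq[OF order_refl] all] sA by (rule ell2_norm_subset(2))
      finally have diff: "\<bar>?a - ?b\<bar> \<le> ?d n" .
      have "\<bar>?a\<^sup>2 - ?b\<^sup>2\<bar> = (?a + ?b) * \<bar>?a - ?b\<bar>"
        using ell2_norm_nonneg[of A "f n"] ell2_norm_nonneg[of "s <# A" "f n"]
        by (simp add: power2_eq_square square_diff_square_factored abs_mult)
      also have "\<dots> \<le> 2 * ?d n"
        using diff le1[OF A, of n] le1[OF sA, of n] ell2_norm_nonneg[of A "f n"]
          ell2_norm_nonneg[of "s <# A" "f n"] by (intro mult_mono) auto
      finally show ?thesis
        using A sA by (simp add: \<nu>_def Int_absorb2)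
    qed
    have "(\<lambda>n. 2 * ?d n) \<longlonglongrightarrow> 0"
      using tendsto_mult_left[OF diff_lim[OF s], of 2] by simp
    with F(2) have "((\<lambda>n. 2 * ?d n) \<longlongrightarrow> 0) F"
      by (rule tendsto_mono)
    then have "((\<lambda>n. \<nu> n (s <# A) - \<nu> n A) \<longlongrightarrow> 0) F"
      by (rule Lim_null_comparison[rotated]) (simp add: bound)
    moreover have "((\<lambda>n. \<nu> n (s <# A) - \<nu> n A) \<longlongrightarrow> \<mu> (s <# A) - \<mu> A) F"
      by (intro tendsto_diff lim)
    ultimately show ?thesis
      using tendsto_unique[OF F(1)] by fastforce
  qed
  moreover have "\<mu> (g <# A) = \<mu> A" if "g \<in> carrier G" "A \<subseteq> carrier G" for g A
    using invariant_under_generators[OF assms(2,1) gen_inv that] .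
  ultimately show ?thesis
    unfolding amenable_def by (intro exI[of _ \<mu>]) auto
qed

text \<open>If the norm is at least \<open>1\<close>, vectors that nearly attain it are almost invariant. The proof compares
translates by two elements of \<open>S\<close> with each other, and \<open>\<one> \<in> S\<close> makes the vector itself one
of these translates.\<close>

theorem spectral_radius_less_one:
  assumes "finite S" "S \<subseteq> carrier G" "generate G S = carrier G" "\<one> \<in> S" "\<not> amenable G"
  shows "spectral_radius G S < 1"
proof (rule ccontr)
  assume "\<not> spectral_radius G S < 1"
  let ?n = "real (card S)"
  have n: "0 < ?n" using assms by (auto simp: card_gt_0_iff)
  define \<delta> where "\<delta> m = inverse (real (Suc m))" for m
  have \<delta>: "0 < \<delta> m" for m by (simp add: \<delta>_def)
  have \<delta>_lim: "\<delta> \<longlonglongrightarrow> 0" unfolding \<delta>_def by (rule LIMSEQ_inverse_real_of_nat)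
  have "\<exists>f. f \<in> ell2 (carrier G) \<and> ell2_norm (carrier G) f \<le> 1 \<and>
    ?n * (1 - \<delta> m) \<le> ell2_norm (carrier G) (translate_sum S f)" for m
  proof (rule ccontr)
    assume "\<not> ?thesis"
    then have "spectral_radius G S \<le> 1 - \<delta> m"
      using assms by (intro spectral_radius_le) (auto simp: mult.commute not_le less_imp_le)
    with \<delta>[of m] \<open>\<not> spectral_radius G S < 1\<close> show False by simp
  qed
  then obtain f where f: "\<And>m. f m \<in> ell2 (carrier G)" "\<And>m. ell2_norm (carrier G) (f m) \<le> 1"
    "\<And>m. ?n * (1 - \<delta> m) \<le> ell2_norm (carrier G) (translate_sum S (f m))"
    by metis
  have "amenable G"
  proof (rule amenable_if_almost_invariant_vectors[OF assms(2,3) f(1,2)])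
    have lower: "1 - \<delta> m \<le> ell2_norm (carrier G) (f m)" for m
    proof -
      have "?n * (1 - \<delta> m) \<le> ?n * ell2_norm (carrier G) (f m)"
        by (rule order_trans[OF f(3) translate_sum_ell2(2)[OF assms(1,2) f(1)]])
      then show ?thesis using n by simp
    qed
    have "(\<lambda>m. 1 - \<delta> m) \<longlonglongrightarrow> 1"
      using tendsto_diff[OF tendsto_const \<delta>_lim, of 1] by simp
    then show "(\<lambda>m. ell2_norm (carrier G) (f m)) \<longlonglongrightarrow> 1"
      by (rule real_tendsto_sandwich[rotated 2, OF _ tendsto_const]) (simp_all add: lower f(2))
  next
    fix s assume s: "s \<in> S"
    let ?d = "\<lambda>m. ell2_norm (carrier G) (\<lambda>x. f m x - left_regular G s (f m) x)"
    have upper: "(?d m)\<^sup>2 \<le> 4 * ?n * \<delta> m" for m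
      using assms(1,2,4) s f \<delta>[of m] by (intro translate_sum_almost_invariant) simp_all
    have "(\<lambda>m. 4 * ?n * \<delta> m) \<longlonglongrightarrow> 0"
      using tendsto_mult_left[OF \<delta>_lim, of "4 * ?n"] by simp
    then have "(\<lambda>m. (?d m)\<^sup>2) \<longlonglongrightarrow> 0"
      by (rule real_tendsto_sandwich[OF _ _ tendsto_const, rotated 2]) (simp_all add: upper)
    then show "?d \<longlonglongrightarrow> 0" by simp
  qed
  with assms(5) show False by blast
qed

section \<open>Sets of small spectral radius\<close>

lemma amenable_if_finite:
  assumes "finite (carrier G)"
  shows "amenable G"
  unfolding amenable_def
proof (intro exI[of _ "\<lambda>A. real (card A) / card (carrier G)"] conjI allI ballI impI)
  have "card (carrier G) > 0" using assms by (auto simp: card_gt_0_iff)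
  then show "real (card (carrier G)) / card (carrier G) = 1" by simp
  fix A assume A: "A \<subseteq> carrier G"
  { fix B assume "B \<subseteq> carrier G" "A \<inter> B = {}"
    then show "real (card (A \<union> B)) / card (carrier G)
        = card A / card (carrier G) + card B / card (carrier G)"
      using A assms by (subst card_Un_disjoint) (auto intro: finite_subset simp: add_divide_distrib) }
  fix g assume g: "g \<in> carrier G"
  have "g <# A = (\<lambda>h. g \<otimes> h) ` A" by (auto simp: l_coset_def)
  moreover have "inj_on (\<lambda>h. g \<otimes> h) A" using inj_on_cmult[OF g] A by (rule inj_on_subset)
  ultimately show "real (card (g <# A)) / card (carrier G) = card A / card (carrier G)"
    by (simp add: card_image)
qed auto

text \<open>For \<open>card S \<le> 1\<close> the logarithm in the final bound vanishes. In that case \<open>S\<close> consists of at most one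
element, which is its own inverse, and the group has order at most \<open>2\<close>,
so it would be amenable.\<close>

lemma two_le_card_generators:
  assumes "finite S" "symmetric_subset G S" "generate G S = carrier G" "\<not> amenable G"
  shows "2 \<le> card S"
proof (rule ccontr)
  assume "\<not> 2 \<le> card S"
  then have "card S = 0 \<or> card S = 1" by linarith
  then obtain a where a: "S \<subseteq> {a}"
    using assms(1) by (auto simp: card_1_singleton_iff)
  have S: "S \<subseteq> carrier G" "\<And>s. s \<in> S \<Longrightarrow> inv s \<in> S"
    using assms(2) by (auto simp: symmetric_subset_def)
  have "x \<in> {\<one>} \<union> S" if "x \<in> generate G S" for x
    using that
  proof induction
    case (eng h1 h2)
    show ?case
    proof (cases "h1 = \<one> \<or> h2 = \<one>")
      case True
      then show ?thesis using eng.IH S(1) by auto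
    next
      case False
      then have "h1 = a" "h2 = a" "a \<in> S" using eng.IH a by auto
      then have "inv a = a" using S(2) a by blast
      then show ?thesis using \<open>h1 = a\<close> \<open>h2 = a\<close> \<open>a \<in> S\<close> S(1) r_inv[of a] by auto
    qed
  qed (use S in auto)
  then have "carrier G \<subseteq> {\<one>} \<union> S" using assms(3) by blast
  then have "finite (carrier G)" by (rule finite_subset) (simp add: assms(1))
  then show False using amenable_if_finite assms(4) by blast
qed

text \<open>Adjoining \<open>S\<close> costs at most \<open>card S / card L\<close>, and \<open>1 / card L\<close> is at most the square of the spectral radius
of \<open>L\<close>. So the enlarged set still has small spectral radius when \<open>L\<close> has.\<close>

lemma spectral_radius_Un_le:
  assumes "finite L" "L \<noteq> {}" "L \<subseteq> carrier G" "finite S" "S \<subseteq> carrier G"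
  shows "spectral_radius G (L \<union> S) \<le> spectral_radius G L + card S * (spectral_radius G L)\<^sup>2"
proof (rule spectral_radius_le)
  let ?\<rho> = "spectral_radius G L"
  fix f assume f: "f \<in> ell2 (carrier G)" "ell2_norm (carrier G) f \<le> 1"
  have R: "finite (S - L)" "S - L \<subseteq> carrier G" using assms by auto
  have sq: "square_summable (carrier G) (translate_sum L f)"
      "square_summable (carrier G) (translate_sum (S - L) f)"
    using translate_sum_ell2(1)[OF _ _ f(1)] R assms by (auto simp: ell2_def)
  have "translate_sum (L \<union> S) f = (\<lambda>x. translate_sum L f x + translate_sum (S - L) f x)"
  proof
    fix x
    have "L \<union> S = L \<union> (S - L)" by blast
    then show "translate_sum (L \<union> S) f x = translate_sum L f x + translate_sum (S - L) f x"
      unfolding translate_sum_def using assms R by (metis Diff_disjoint sum.union_disjoint)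
  qed
  then have "ell2_norm (carrier G) (translate_sum (L \<union> S) f)
      \<le> ell2_norm (carrier G) (translate_sum L f) + ell2_norm (carrier G) (translate_sum (S - L) f)"
    using ell2_norm_triangle(2)[OF sq] by simp
  also have "\<dots> \<le> card L * ?\<rho> + card S"
  proof (intro add_mono)
    show "ell2_norm (carrier G) (translate_sum L f) \<le> card L * ?\<rho>"
      using assms f by (intro ell2_norm_translate_sum_unit_le)
    have "ell2_norm (carrier G) (translate_sum (S - L) f) \<le> card (S - L) * ell2_norm (carrier G) f"
      by (rule translate_sum_ell2(2)[OF R f(1)])
    also have "\<dots> \<le> real (card S) * 1"
      using f(2) assms ell2_norm_nonneg by (intro mult_mono) (auto intro: card_mono)
    finally show "ell2_norm (carrier G) (translate_sum (S - L) f) \<le> card S" by simp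
  qed
  also have "\<dots> \<le> (?\<rho> + card S * ?\<rho>\<^sup>2) * card L"
  proof -
    have "1 \<le> ?\<rho>\<^sup>2 * card L"
      using inverse_card_le_spectral_radius_squared[OF assms(1-3)] assms(1,2)
      by (simp add: pos_divide_le_eq card_gt_0_iff)
    then have "real (card S) * 1 \<le> card S * (?\<rho>\<^sup>2 * card L)"
      by (intro mult_left_mono) auto
    then show ?thesis by (simp add: algebra_simps)
  qed
  also have "\<dots> \<le> (?\<rho> + card S * ?\<rho>\<^sup>2) * card (L \<union> S)"
    using assms spectral_radius_nonneg[OF assms(1-3)]
    by (intro mult_left_mono) (simp_all add: card_mono)
  finally show "ell2_norm (carrier G) (translate_sum (L \<union> S) f)
    \<le> (?\<rho> + card S * ?\<rho>\<^sup>2) * card (L \<union> S)" .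
qed (use assms in auto)

theorem exists_subset_of_power:
  assumes "finite S" "symmetric_subset G S" "generate G S = carrier G" "\<not> amenable G" "1 \<le> k"
  shows "\<exists>L. L \<noteq> {} \<and> L \<subseteq> set_pow G S k \<and> symmetric_subset G L \<and>
    spectral_radius G L \<le> 4 * real k * ln (card S) * spectral_radius G S ^ k"
proof -
  have n: "2 \<le> card S" using assms by (intro two_le_card_generators)
  then have "S \<noteq> {}" by auto
  obtain L where L: "L \<noteq> {}" "L \<subseteq> set_pow G S k" "symmetric_subset G L"
    "spectral_radius G L \<le> (1 + real k * ln (card S)) * spectral_radius G S ^ k"
    using exists_level_set[OF assms(1) \<open>S \<noteq> {}\<close> assms(2)] by blast
  \<comment> \<open>For \<open>2 \<le> card S\<close> the additive constant \<open>1\<close> is absorbed by \<open>3 * k * ln (card S)\<close>.\<close>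
  have "1 / 2 \<le> ln (2 :: real)"
    using ln2_ge_two_thirds by simp
  also have "\<dots> \<le> ln (card S)" using n by simp
  also have "\<dots> \<le> k * ln (card S)"
    using assms(5) n by (simp add: mult_le_cancel_right1)
  finally have "1 + real k * ln (card S) \<le> 4 * real k * ln (card S)" by simp
  then have weaken: "(1 + real k * ln (card S)) * spectral_radius G S ^ k
      \<le> 4 * real k * ln (card S) * spectral_radius G S ^ k"
    using spectral_radius_nonneg[OF assms(1) \<open>S \<noteq> {}\<close>] assms(2)
    by (intro mult_right_mono) (auto simp: symmetric_subset_def)
  show ?thesis
    using L(1-3) order_trans[OF L(4) weaken] by (intro exI[of _ L] conjI)
qed

text \<open>Adjoining \<open>\<one>\<close> to the generators makes their spectral radius less than \<open>1\<close>, so the bound of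
\<open>exists_subset_of_power\<close> tends to \<open>0\<close> as \<open>k\<close> grows. The sets obtained this way need not generate
the group, hence the union with \<open>U\<close>.\<close>

theorem exists_generating_set_small_spectral_radius:
  assumes "finite S" "symmetric_subset G S" "generate G S = carrier G" "\<not> amenable G" "0 < \<epsilon>"
  shows "\<exists>T. T \<noteq> {} \<and> finite T \<and> symmetric_subset G T \<and> generate G T = carrier G \<and>
    spectral_radius G T < \<epsilon>"
proof -
  define U where "U = insert \<one> S"
  have S: "S \<subseteq> carrier G" using assms(2) by (simp add: symmetric_subset_def)
  have gen: "generate G T = carrier G" if "S \<subseteq> T" "T \<subseteq> carrier G" for T
    using mono_generate[OF that(1)] generate_incl[OF that(2)] assms(3) by blast
  have U: "finite U" "U \<subseteq> carrier G" "U \<noteq> {}" "symmetric_subset G U" "generate G U = carrier G"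
    using assms(1,2) S gen[of U] by (auto simp: U_def symmetric_subset_def)
  let ?r = "spectral_radius G U" and ?n = "real (card U)"
  have "?r < 1"
    using U assms(4) by (intro spectral_radius_less_one) (auto simp: U_def)
  then have r: "norm ?r < 1"
    using spectral_radius_nonneg[OF U(1,3,2)] by simp
  define b where "b k = 4 * real k * ln (card U) * ?r ^ k" for k
  have "(\<lambda>k. 4 * ln (card U) * (real k * ?r ^ k)) \<longlonglongrightarrow> 4 * ln (card U) * 0"
    by (intro tendsto_mult_left powser_times_n_limit_0 r)
  then have "b \<longlonglongrightarrow> 0"
    by (simp add: b_def[abs_def] mult.assoc mult.left_commute)
  then have "(\<lambda>k. b k + ?n * (b k)\<^sup>2) \<longlonglongrightarrow> 0 + ?n * 0\<^sup>2"
    by (intro tendsto_intros)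
  then have "eventually (\<lambda>k. b k + ?n * (b k)\<^sup>2 < \<epsilon>) sequentially"
    using assms(5) by (intro order_tendstoD(2)[where y = "0 + ?n * 0\<^sup>2"]) auto
  then obtain k where k: "1 \<le> k" "b k + ?n * (b k)\<^sup>2 < \<epsilon>"
    using eventually_conj[OF eventually_ge_at_top[of 1]] eventually_happens'[OF sequentially_bot] by blast
  obtain L where L: "L \<noteq> {}" "L \<subseteq> set_pow G U k" "symmetric_subset G L" "spectral_radius G L \<le> b k"
    using exists_subset_of_power[OF U(1,4,5) assms(4) k(1)] by (auto simp: b_def)
  have finL: "finite L"
    using L(2) finite_words[OF U(1)] unfolding set_pow_eq by (meson finite_imageI finite_subset)
  have LG: "L \<subseteq> carrier G"
    using L(3) by (simp add: symmetric_subset_def)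
  have "spectral_radius G (L \<union> U) \<le> spectral_radius G L + ?n * (spectral_radius G L)\<^sup>2"
    by (rule spectral_radius_Un_le[OF finL L(1) LG U(1,2)])
  also have "\<dots> \<le> b k + ?n * (b k)\<^sup>2"
    using L(4) spectral_radius_nonneg[OF finL L(1) LG]
    by (intro add_mono mult_left_mono power_mono) auto
  finally have "spectral_radius G (L \<union> U) < \<epsilon>" using k(2) by simp
  moreover have "symmetric_subset G (L \<union> U)"
    using L(3) U(4) by (auto simp: symmetric_subset_def)
  moreover have "generate G (L \<union> U) = carrier G"
    using LG U(2) by (intro gen) (auto simp: U_def)
  ultimately show ?thesis
    using finL U(1) L(1) by (intro exI[of _ "L \<union> U"]) auto
qed

end

theorem theorem1:
  fixes \<Gamma> :: "('a, 'b) monoid_scheme" and \<Sigma> :: "'a set"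
  assumes "group \<Gamma>"
    and "finitely_generated \<Gamma>"
    and "\<not> amenable \<Gamma>"
    and "finite \<Sigma>"
    and "symmetric_subset \<Gamma> \<Sigma>"
    and "generating_set \<Gamma> \<Sigma>"
  shows "(\<forall>k::nat. k \<ge> 1 \<longrightarrow>
            (\<exists>S. S \<noteq> {} \<and> S \<subseteq> set_pow \<Gamma> \<Sigma> k \<and> symmetric_subset \<Gamma> S \<and>
               spectral_radius \<Gamma> S \<le> 4 * real k * ln (real (card \<Sigma>)) * spectral_radius \<Gamma> \<Sigma> ^ k))
       \<and> (\<forall>\<epsilon>::real. \<epsilon> > 0 \<longrightarrow>
            (\<exists>S. S \<noteq> {} \<and> finite S \<and> symmetric_subset \<Gamma> S \<and> generating_set \<Gamma> S \<and>
               spectral_radius \<Gamma> S < \<epsilon>))"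
proof -
  interpret group \<Gamma> by fact
  have gen: "generate \<Gamma> \<Sigma> = carrier \<Gamma>"
    using assms(6) by (simp add: generating_set_def)
  show ?thesis
  proof (intro conjI allI impI)
    fix k :: nat assume "k \<ge> 1"
    then show "\<exists>S. S \<noteq> {} \<and> S \<subseteq> set_pow \<Gamma> \<Sigma> k \<and> symmetric_subset \<Gamma> S \<and>
        spectral_radius \<Gamma> S \<le> 4 * real k * ln (real (card \<Sigma>)) * spectral_radius \<Gamma> \<Sigma> ^ k"
      by (rule exists_subset_of_power[OF assms(4,5) gen assms(3)])
  next
    fix \<epsilon> :: real assume "\<epsilon> > 0"
    then obtain S where "S \<noteq> {}" "finite S" "symmetric_subset \<Gamma> S"
      "generate \<Gamma> S = carrier \<Gamma>" "spectral_radius \<Gamma> S < \<epsilon>"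
      using exists_generating_set_small_spectral_radius[OF assms(4,5) gen assms(3)] by blast
    then show "\<exists>S. S \<noteq> {} \<and> finite S \<and> symmetric_subset \<Gamma> S \<and> generating_set \<Gamma> S \<and>
        spectral_radius \<Gamma> S < \<epsilon>"
      by (auto simp: generating_set_def symmetric_subset_def)
  qed
qed

end
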